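(* Under any CLC choice model, if a price vector $\mathbf p\in[0,\bar v]^N$ is a local Nash equilibrium, then there exists an ordering $\pi$ of the sellers such that $(\pi,\mathbf p)$ is a valid order-price pair.
   Context: CLC setup. There are $N$ sellers $\mathcal N=\{1,\dots,N\}$, each selling one item, and a unit mass of customers, each buying at most one item. Items have a price attribute (indexed $0$) and $K$ non-price attributes indexed by $\mathcal A=\{1,\dots,K\}$; $\bar{\mathcal A}=\{0\}\cup\mathcal A$. Non-price attribute $k$ takes values in an arbitrary set $\mathcal V^k$; prices lie in $\mathcal V=[0,\bar v]$ for a fixed $\bar v>0$. Seller $i$'s item has fixed non-price attribute values $v_i^k\in\mathcal V^k$ and price $p_i\in\mathcal V$ chosen by seller $i$; $\mathbf p=(p_1,\dots,p_N)$, and $v_i^0:=p_i$. Each customer $c$ has: a strict total order $\succ_c$ on $\bar{\mathcal A}$ (attribute importance); for each attribute $k$ a complete transitive weak preference $\succsim_c^k$ on its value set, with strict part $\succ_c^k$ and indifference $\sim_c^k$ (and $v\sim_c^k v$), where for price $p\succ_c^0p'$ iff $p<p'$ and $p\sim_c^0p'$ iff $p=p'$; a willingness-to-pay $w_c\in[0,\bar v]$; a set $\mathcal C_c\subseteq\mathcal V^1\times\cdots\times\mathcal V^K$ of admissible non-price attribute vectors; and a strict tie-breaking order over sellers. Customer $c$ lexicographically prefers item $i$ to item $j$ if there is an attribute $k$ with $v_i^{k'}\sim_c^{k'}v_j^{k'}$ for all $k'\succ_c k$ and $v_i^k\succ_c^k v_j^k$; if no such $k$ exists, the tie-breaking order decides.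 Under the Consider-then-Choose with Lexicographic Choice (CLC) model, customer $c$ forms the consideration set $\mathcal N_c=\{i\in\mathcal N: p_i\le w_c,\ (v_i^1,\dots,v_i^K)\in\mathcal C_c\}$, buys nothing if it is empty, and otherwise buys the top-ranked item of $\mathcal N_c$ under this lexicographic order (with tie-breaking). An instance of CLC choice is a joint distribution $\mathcal G$ of these customer primitives; the conditional distribution of $w_c$ given the other primitives is assumed to have a Lipschitz continuous density. $D_i(\mathbf p)$ is the probability a customer buys from seller $i$ and $R_i(\mathbf p)=p_iD_i(\mathbf p)$ is seller $i$'s revenue, also written $R_i(p_i,\mathbf p_{-i})$. Local Nash equilibrium (LNE): $\mathbf p$ with $p_i\in\mathcal V$ for all $i$ such that there exist open neighborhoods $\mathcal U_i\subseteq\mathbb R$ with $p_i\in\mathcal U_i$ and $p_i\in\arg\max_{p\in\overline{\mathcal U_i}}R_i(p,\mathbf p_{-i})$ for all $i$ ($\overline{\mathcal U}$ is the closure). Notation: for $\mathcal S\subseteq\mathcal N$, $\mathbf p^{\mathcal S}$ is the price vector keeping the prices of sellers in $\mathcal S$ and setting the prices of all sellers outside $\mathcal S$ to $0$; $p^{\min}(\mathcal S)=\min_{j\in\mathcal S}p_j$, with $p^{\min}(\emptyset)=\bar v$. Valid order-price pair (VOP): a pair $(\pi,\mathbf p)$ where $\pi:[N]\to\mathcal N$ is a bijection ($\pi(l)$ is the seller of rank $l$) and $\mathbf p\in\mathcal V^N$ satisfies (1) $0\le p_{\pi(N)}\le\cdots\le p_{\pi(1)}\le\bar v$, and (2) letting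 $\mathcal S_1=\emptyset$ and $\mathcal S_l=\{\pi(j):j<l\}$, for every $l$ the price $p_{\pi(l)}$ is a local maximum of $p\mapsto R_{\pi(l)}(p,\mathbf p^{\mathcal S_l}_{-\pi(l)})$ on the interval $[0,p^{\min}(\mathcal S_l)]$. *)

theory Defs
  imports "HOL-Probability.Probability"
begin

text \<open>Attributes are indexed 0..K (0 = price); sellers are indexed 1..N.
  imp c a b : attribute a is more important than attribute b for customer c.
  pref c k x y : x is weakly preferred to y for non-price attribute k (k in 1..K).
  adm c : admissible non-price attribute vectors (functions on {1..K}, PiE style).
  tb c i j : seller i is ranked above seller j in the tie-breaking order.\<close>
record 'v cust =
  imp :: "nat \<Rightarrow> nat \<Rightarrow> bool"
  pref :: "nat \<Rightarrow> 'v \<Rightarrow> 'v \<Rightarrow> bool"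
  adm :: "(nat \<Rightarrow> 'v) set"
  tb :: "nat \<Rightarrow> nat \<Rightarrow> bool"

definition strict_total_on :: "'a set \<Rightarrow> ('a \<Rightarrow> 'a \<Rightarrow> bool) \<Rightarrow> bool" where
  "strict_total_on A r \<longleftrightarrow> (\<forall>a\<in>A. \<not> r a a) \<and>
     (\<forall>a\<in>A. \<forall>b\<in>A. \<forall>d\<in>A. r a b \<longrightarrow> r b d \<longrightarrow> r a d) \<and>
     (\<forall>a\<in>A. \<forall>b\<in>A. a \<noteq> b \<longrightarrow> r a b \<or> r b a)"

definition weak_order_on :: "'a set \<Rightarrow> ('a \<Rightarrow> 'a \<Rightarrow> bool) \<Rightarrow> bool" where
  "weak_order_on A r \<longleftrightarrow> (\<forall>a\<in>A. \<forall>b\<in>A. r a b \<or> r b a) \<and>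
     (\<forall>a\<in>A. \<forall>b\<in>A. \<forall>d\<in>A. r a b \<longrightarrow> r b d \<longrightarrow> r a d)"

text \<open>vals i k : value of non-price attribute k of seller i; p i : price of seller i.\<close>
definition att_strict :: "'v cust \<Rightarrow> (nat \<Rightarrow> nat \<Rightarrow> 'v) \<Rightarrow> (nat \<Rightarrow> real) \<Rightarrow> nat \<Rightarrow> nat \<Rightarrow> nat \<Rightarrow> bool" where
  "att_strict c vals p k i j \<longleftrightarrow>
     (if k = 0 then p i < p j
      else pref c k (vals i k) (vals j k) \<and> \<not> pref c k (vals j k) (vals i k))"

definition att_indiff :: "'v cust \<Rightarrow> (nat \<Rightarrow> nat \<Rightarrow> 'v) \<Rightarrow> (nat \<Rightarrow> real) \<Rightarrow> nat \<Rightarrow> nat \<Rightarrow> nat \<Rightarrow> bool" where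
  "att_indiff c vals p k i j \<longleftrightarrow>
     (if k = 0 then p i = p j
      else pref c k (vals i k) (vals j k) \<and> pref c k (vals j k) (vals i k))"

definition lex_pref :: "'v cust \<Rightarrow> nat \<Rightarrow> (nat \<Rightarrow> nat \<Rightarrow> 'v) \<Rightarrow> (nat \<Rightarrow> real) \<Rightarrow> nat \<Rightarrow> nat \<Rightarrow> bool" where
  "lex_pref c K vals p i j \<longleftrightarrow>
     (\<exists>k\<in>{0..K}. (\<forall>k'\<in>{0..K}. imp c k' k \<longrightarrow> att_indiff c vals p k' i j) \<and> att_strict c vals p k i j)"

definition ranks_above :: "'v cust \<Rightarrow> nat \<Rightarrow> (nat \<Rightarrow> nat \<Rightarrow> 'v) \<Rightarrow> (nat \<Rightarrow> real) \<Rightarrow> nat \<Rightarrow> nat \<Rightarrow> bool" where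
  "ranks_above c K vals p i j \<longleftrightarrow>
     lex_pref c K vals p i j \<or>
     (\<not> lex_pref c K vals p i j \<and> \<not> lex_pref c K vals p j i \<and> tb c i j)"

definition consider_set :: "'v cust \<Rightarrow> nat \<Rightarrow> nat \<Rightarrow> (nat \<Rightarrow> nat \<Rightarrow> 'v) \<Rightarrow> real \<Rightarrow> (nat \<Rightarrow> real) \<Rightarrow> nat set" where
  "consider_set c N K vals w p = {i \<in> {1..N}. p i \<le> w \<and> restrict (vals i) {1..K} \<in> adm c}"

definition buys :: "'v cust \<Rightarrow> nat \<Rightarrow> nat \<Rightarrow> (nat \<Rightarrow> nat \<Rightarrow> 'v) \<Rightarrow> real \<Rightarrow> (nat \<Rightarrow> real) \<Rightarrow> nat \<Rightarrow> bool" where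
  "buys c N K vals w p i \<longleftrightarrow> i \<in> consider_set c N K vals w p \<and>
     (\<forall>j\<in>consider_set c N K vals w p. j \<noteq> i \<longrightarrow> ranks_above c K vals p i j)"

text \<open>Joint distribution of customer primitives: marginal Theta of the non-price primitives,
  and conditional density f c of the willingness-to-pay on [0, vb].\<close>
definition cust_meas :: "'v cust measure \<Rightarrow> ('v cust \<Rightarrow> real \<Rightarrow> real) \<Rightarrow> real \<Rightarrow> ('v cust \<times> real) measure" where
  "cust_meas Theta f vb = density (Theta \<Otimes>\<^sub>M lborel)
     (\<lambda>x. ennreal (f (fst x) (snd x) * indicator {0..vb} (snd x)))"

definition buy_set :: "'v cust measure \<Rightarrow> nat \<Rightarrow> nat \<Rightarrow> (nat \<Rightarrow> nat \<Rightarrow> 'v) \<Rightarrow> (nat \<Rightarrow> real) \<Rightarrow> nat \<Rightarrow> ('v cust \<times> real) set" where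
  "buy_set Theta N K vals p i = {x \<in> space (Theta \<Otimes>\<^sub>M lborel). buys (fst x) N K vals (snd x) p i}"

definition demand :: "nat \<Rightarrow> nat \<Rightarrow> (nat \<Rightarrow> nat \<Rightarrow> 'v) \<Rightarrow> 'v cust measure \<Rightarrow> ('v cust \<Rightarrow> real \<Rightarrow> real) \<Rightarrow> real \<Rightarrow> nat \<Rightarrow> (nat \<Rightarrow> real) \<Rightarrow> real" where
  "demand N K vals Theta f vb i p = measure (cust_meas Theta f vb) (buy_set Theta N K vals p i)"

definition revenue :: "nat \<Rightarrow> nat \<Rightarrow> (nat \<Rightarrow> nat \<Rightarrow> 'v) \<Rightarrow> 'v cust measure \<Rightarrow> ('v cust \<Rightarrow> real \<Rightarrow> real) \<Rightarrow> real \<Rightarrow> nat \<Rightarrow> (nat \<Rightarrow> real) \<Rightarrow> real" where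
  "revenue N K vals Theta f vb i p = p i * demand N K vals Theta f vb i p"

definition clc_instance :: "nat \<Rightarrow> nat \<Rightarrow> (nat \<Rightarrow> 'v set) \<Rightarrow> (nat \<Rightarrow> nat \<Rightarrow> 'v) \<Rightarrow> real \<Rightarrow> 'v cust measure \<Rightarrow> ('v cust \<Rightarrow> real \<Rightarrow> real) \<Rightarrow> bool" where
  "clc_instance N K V vals vb Theta f \<longleftrightarrow>
     0 < vb \<and> prob_space Theta \<and>
     (\<forall>i\<in>{1..N}. \<forall>k\<in>{1..K}. vals i k \<in> V k) \<and>
     (\<forall>c\<in>space Theta.
        strict_total_on {0..K} (imp c) \<and>
        (\<forall>k\<in>{1..K}. weak_order_on (V k) (pref c k)) \<and>
        adm c \<subseteq> PiE {1..K} V \<and>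
        strict_total_on {1..N} (tb c)) \<and>
     (\<lambda>x. f (fst x) (snd x)) \<in> borel_measurable (Theta \<Otimes>\<^sub>M lborel) \<and>
     (\<forall>c\<in>space Theta. (\<forall>w\<in>{0..vb}. 0 \<le> f c w) \<and> (f c has_integral 1) {0..vb}) \<and>
     (\<exists>L. \<forall>c\<in>space Theta. L-lipschitz_on {0..vb} (f c)) \<and>
     (\<forall>p i. buy_set Theta N K vals p i \<in> sets (Theta \<Otimes>\<^sub>M lborel))"

definition is_LNE :: "nat \<Rightarrow> real \<Rightarrow> (nat \<Rightarrow> (nat \<Rightarrow> real) \<Rightarrow> real) \<Rightarrow> (nat \<Rightarrow> real) \<Rightarrow> bool" where
  "is_LNE N vb R p \<longleftrightarrow>
     (\<forall>i\<in>{1..N}. p i \<in> {0..vb} \<and>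
        (\<exists>U. open U \<and> p i \<in> U \<and> (\<forall>x\<in>closure U. R i (p(i := x)) \<le> R i p)))"

definition prices_on :: "nat set \<Rightarrow> (nat \<Rightarrow> real) \<Rightarrow> (nat \<Rightarrow> real)" where
  "prices_on S p = (\<lambda>j. if j \<in> S then p j else 0)"

definition pmin :: "real \<Rightarrow> (nat \<Rightarrow> real) \<Rightarrow> nat set \<Rightarrow> real" where
  "pmin vb p S = (if S = {} then vb else Min (p ` S))"

definition is_VOP :: "nat \<Rightarrow> real \<Rightarrow> (nat \<Rightarrow> (nat \<Rightarrow> real) \<Rightarrow> real) \<Rightarrow> (nat \<Rightarrow> nat) \<Rightarrow> (nat \<Rightarrow> real) \<Rightarrow> bool" where
  "is_VOP N vb R \<pi> p \<longleftrightarrow>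
     bij_betw \<pi> {1..N} {1..N} \<and>
     (\<forall>i\<in>{1..N}. p i \<in> {0..vb}) \<and>
     (1 \<le> N \<longrightarrow> 0 \<le> p (\<pi> N) \<and> p (\<pi> 1) \<le> vb) \<and>
     (\<forall>l\<in>{1..<N}. p (\<pi> (Suc l)) \<le> p (\<pi> l)) \<and>
     (\<forall>l\<in>{1..N}.
        \<exists>\<epsilon>>0. \<forall>x\<in>{0..pmin vb p (\<pi> ` {1..<l})}. \<bar>x - p (\<pi> l)\<bar> < \<epsilon> \<longrightarrow>
          R (\<pi> l) ((prices_on (\<pi> ` {1..<l}) p)(\<pi> l := x))
            \<le> R (\<pi> l) ((prices_on (\<pi> ` {1..<l}) p)(\<pi> l := p (\<pi> l))))"

end

theory Submission
  imports Defs
begin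

text \<open>Sort the sellers by decreasing price and consider the seller i of rank l. Setting the prices
  of the sellers ranked below i to 0 can only lower i's demand, because a customer's lexicographic
  ranking of i against a rival is monotone in the two prices; so near p i the revenue of i against
  the modified prices is bounded by its revenue against p, which the local equilibrium bounds by
  R i p. At x = p i there is no loss: zeroing a price strictly below p i changes no comparison with
  i for a customer who can afford i, and a tied rival that would win a positive mass of i's customers
  by dropping its price to 0 would win them, on top of its own, by undercutting p i slightly,
  contradicting the equilibrium.\<close>

lemma strict_total_onD:
  assumes "strict_total_on A r"
  shows strict_total_on_irrefl: "a \<in> A \<Longrightarrow> \<not> r a a"
    and strict_total_on_trans: "a \<in> A \<Longrightarrow> b \<in> A \<Longrightarrow> d \<in> A \<Longrightarrow> r a b \<Longrightarrow> r b d \<Longrightarrow> r a d"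
    and strict_total_on_total: "a \<in> A \<Longrightarrow> b \<in> A \<Longrightarrow> a \<noteq> b \<Longrightarrow> r a b \<or> r b a"
  using assms unfolding strict_total_on_def by (meson, meson, meson)

lemma strict_total_on_ex_min:
  assumes r: "strict_total_on A r" and "D \<subseteq> A" "finite D" "D \<noteq> {}"
  shows "\<exists>a\<in>D. \<forall>b\<in>D. \<not> r b a"
  using \<open>finite D\<close> \<open>D \<noteq> {}\<close> \<open>D \<subseteq> A\<close>
proof (induction D rule: finite_ne_induct)
  case (singleton x)
  then show ?case using strict_total_on_irrefl[OF r] by simp
next
  case (insert x D)
  then obtain a where a: "a \<in> D" "\<forall>b\<in>D. \<not> r b a" by auto
  show ?case
  proof (cases "r x a")
    case True
    have "\<not> r b x" if "b \<in> insert x D" for b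
      using strict_total_on_irrefl[OF r] strict_total_on_trans[OF r, of b x a] True a that insert.prems
      by auto
    then show ?thesis by blast
  next
    case False
    then show ?thesis using a by blast
  qed
qed

lemma le_of_mult_le_left_nbhd:
  fixes a b q e :: real
  assumes "0 < q" "0 < e" and le: "\<And>y. q - e < y \<Longrightarrow> y < q \<Longrightarrow> y * a \<le> q * b"
  shows "a \<le> b"
proof -
  have "eventually (\<lambda>y. y * a \<le> q * b) (at_left q)"
    using eventually_at_left_real[of "q - e" q] \<open>0 < e\<close> by (auto elim: eventually_mono intro: le)
  moreover have "((\<lambda>y. y * a) \<longlongrightarrow> q * a) (at_left q)" by (intro tendsto_intros)
  ultimately have "q * a \<le> q * b" by (intro tendsto_upperbound) auto
  then show ?thesis using \<open>0 < q\<close> by simp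
qed

lemma ex_bij_sorted_desc:
  fixes p :: "nat \<Rightarrow> real"
  obtains \<pi> where "bij_betw \<pi> {1..N} {1..N}"
    and "\<And>l m. l \<in> {1..N} \<Longrightarrow> m \<in> {1..N} \<Longrightarrow> l \<le> m \<Longrightarrow> p (\<pi> m) \<le> p (\<pi> l)"
proof -
  define xs where "xs = sort_key (\<lambda>j. - p j) [1..<Suc N]"
  have len: "length xs = N" and "distinct xs" "set xs = {1..N}"
    and sorted: "sorted (map (\<lambda>j. - p j) xs)" unfolding xs_def by auto
  have "bij_betw (\<lambda>l. l - 1) {1..N} {..<N}"
    by (rule bij_betw_byWitness[where f' = Suc]) auto
  moreover have "bij_betw ((!) xs) {..<N} {1..N}"
    by (rule bij_betw_nth) (use \<open>distinct xs\<close> \<open>set xs = {1..N}\<close> len in auto)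
  ultimately have "bij_betw (\<lambda>l. xs ! (l - 1)) {1..N} {1..N}"
    using bij_betw_trans by (auto simp: comp_def)
  moreover have "p (xs ! (m - 1)) \<le> p (xs ! (l - 1))"
    if "l \<in> {1..N}" "m \<in> {1..N}" "l \<le> m" for l m
    using sorted_nth_mono[OF sorted, of "l - 1" "m - 1"] that len by auto
  ultimately show thesis using that by blast
qed

lemma sorted_desc_prefix:
  fixes p :: "nat \<Rightarrow> real"
  assumes bij: "bij_betw \<pi> {1..N} {1..N}"
    and desc: "\<And>l m. l \<in> {1..N} \<Longrightarrow> m \<in> {1..N} \<Longrightarrow> l \<le> m \<Longrightarrow> p (\<pi> m) \<le> p (\<pi> l)"
    and l: "l \<in> {1..N}"
  shows "\<pi> l \<notin> \<pi> ` {1..<l}"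
    and "\<And>j. j \<in> {1..N} \<Longrightarrow> p (\<pi> l) < p j \<Longrightarrow> j \<in> \<pi> ` {1..<l}"
proof -
  show "\<pi> l \<notin> \<pi> ` {1..<l}"
  proof
    assume "\<pi> l \<in> \<pi> ` {1..<l}"
    then obtain m where "m \<in> {1..<l}" "\<pi> l = \<pi> m" by blast
    moreover from this have "m \<in> {1..N}" using l by simp
    ultimately show False using inj_onD[OF bij_betw_imp_inj_on[OF bij] _ l] by fastforce
  qed
next
  fix j assume "j \<in> {1..N}" "p (\<pi> l) < p j"
  then obtain m where m: "m \<in> {1..N}" "j = \<pi> m" using bij unfolding bij_betw_def by blast
  have "\<not> l \<le> m" using desc[OF l m(1)] \<open>p (\<pi> l) < p j\<close> m(2) by fastforce
  with m show "j \<in> \<pi> ` {1..<l}" by simp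
qed

section \<open>Lexicographic ranking\<close>

definition clc_customer :: "nat \<Rightarrow> nat \<Rightarrow> (nat \<Rightarrow> 'v set) \<Rightarrow> (nat \<Rightarrow> nat \<Rightarrow> 'v) \<Rightarrow> 'v cust \<Rightarrow> bool" where
  "clc_customer N K V vals c \<longleftrightarrow> strict_total_on {0..K} (imp c) \<and>
     (\<forall>k\<in>{1..K}. weak_order_on (V k) (pref c k)) \<and>
     (\<forall>i\<in>{1..N}. \<forall>k\<in>{1..K}. vals i k \<in> V k) \<and> strict_total_on {1..N} (tb c)"

lemma clc_customer_pref:
  assumes "clc_customer N K V vals c" "k \<in> {1..K}"
  shows "weak_order_on (V k) (pref c k)" "\<And>i. i \<in> {1..N} \<Longrightarrow> vals i k \<in> V k"
  using assms unfolding clc_customer_def by auto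

definition att_weak :: "'v cust \<Rightarrow> (nat \<Rightarrow> nat \<Rightarrow> 'v) \<Rightarrow> (nat \<Rightarrow> real) \<Rightarrow> nat \<Rightarrow> nat \<Rightarrow> nat \<Rightarrow> bool" where
  "att_weak c vals P k i j \<longleftrightarrow> (if k = 0 then P i \<le> P j else pref c k (vals i k) (vals j k))"

lemma att_strict_iff_weak:
  "att_strict c vals P k i j \<longleftrightarrow> att_weak c vals P k i j \<and> \<not> att_weak c vals P k j i"
  by (auto simp: att_strict_def att_weak_def)

lemma att_indiff_iff_weak:
  "att_indiff c vals P k i j \<longleftrightarrow> att_weak c vals P k i j \<and> att_weak c vals P k j i"
  by (auto simp: att_indiff_def att_weak_def)

lemma att_weak_total:
  assumes c: "clc_customer N K V vals c" and k: "k \<in> {0..K}" and ij: "i \<in> {1..N}" "j \<in> {1..N}"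
  shows "att_weak c vals P k i j \<or> att_weak c vals P k j i"
proof (cases "k = 0")
  case False
  then have "k \<in> {1..K}" using k by auto
  with c ij show ?thesis
    using clc_customer_pref False unfolding att_weak_def weak_order_on_def by metis
qed (auto simp: att_weak_def)

lemma att_weak_trans:
  assumes c: "clc_customer N K V vals c" and k: "k \<in> {0..K}"
    and ijh: "i \<in> {1..N}" "j \<in> {1..N}" "h \<in> {1..N}"
    and "att_weak c vals P k i j" "att_weak c vals P k j h"
  shows "att_weak c vals P k i h"
proof (cases "k = 0")
  case False
  then have "k \<in> {1..K}" using k by auto
  with c ijh assms(6,7) show ?thesis
    using clc_customer_pref False unfolding att_weak_def weak_order_on_def by metis
qed (use assms(6,7) in \<open>auto simp: att_weak_def\<close>)

lemma att_trans:
  assumes c: "clc_customer N K V vals c" and k: "k \<in> {0..K}"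
    and ijh: "i \<in> {1..N}" "j \<in> {1..N}" "h \<in> {1..N}"
  shows att_indiff_trans:
      "att_indiff c vals P k i j \<Longrightarrow> att_indiff c vals P k j h \<Longrightarrow> att_indiff c vals P k i h"
    and att_strict_indiff_trans:
      "att_strict c vals P k i j \<Longrightarrow> att_indiff c vals P k j h \<Longrightarrow> att_strict c vals P k i h"
    and att_indiff_strict_trans:
      "att_indiff c vals P k i j \<Longrightarrow> att_strict c vals P k j h \<Longrightarrow> att_strict c vals P k i h"
    and att_strict_trans:
      "att_strict c vals P k i j \<Longrightarrow> att_strict c vals P k j h \<Longrightarrow> att_strict c vals P k i h"
  using att_weak_trans[OF c k] ijh unfolding att_strict_iff_weak att_indiff_iff_weak by meson+

lemma att_indiff_sym: "att_indiff c vals P k i j \<longleftrightarrow> att_indiff c vals P k j i"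
  by (auto simp: att_indiff_def)

lemma att_strict_not_indiff: "att_strict c vals P k i j \<Longrightarrow> \<not> att_indiff c vals P k i j"
  by (auto simp: att_indiff_def att_strict_def)

lemma lex_prefI:
  assumes "k \<in> {0..K}" "\<And>k'. k' \<in> {0..K} \<Longrightarrow> imp c k' k \<Longrightarrow> att_indiff c vals P k' i j"
    and "att_strict c vals P k i j"
  shows "lex_pref c K vals P i j"
  unfolding lex_pref_def using assms by blast

lemma lex_prefE:
  assumes "lex_pref c K vals P i j"
  obtains k where "k \<in> {0..K}" "att_strict c vals P k i j"
    and "\<And>k'. k' \<in> {0..K} \<Longrightarrow> imp c k' k \<Longrightarrow> att_indiff c vals P k' i j"
proof -
  from assms obtain k where "k \<in> {0..K}" "att_strict c vals P k i j"
    and "\<forall>k'\<in>{0..K}. imp c k' k \<longrightarrow> att_indiff c vals P k' i j"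
    unfolding lex_pref_def by blast
  then show thesis using that by blast
qed

lemma lex_pref_asym:
  assumes imp: "strict_total_on {0..K} (imp c)" and "lex_pref c K vals P i j"
  shows "\<not> lex_pref c K vals P j i"
proof
  assume "lex_pref c K vals P j i"
  then obtain l where l: "l \<in> {0..K}" "att_strict c vals P l j i"
    and above_l: "\<And>k'. k' \<in> {0..K} \<Longrightarrow> imp c k' l \<Longrightarrow> att_indiff c vals P k' j i"
    by (elim lex_prefE) blast
  obtain k where k: "k \<in> {0..K}" "att_strict c vals P k i j"
    and above_k: "\<And>k'. k' \<in> {0..K} \<Longrightarrow> imp c k' k \<Longrightarrow> att_indiff c vals P k' i j"
    using \<open>lex_pref c K vals P i j\<close> by (elim lex_prefE) blast
  consider "k = l" | "imp c k l" | "imp c l k" using strict_total_on_total[OF imp k(1) l(1)] by blast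
  then show False
  proof cases
    case 1
    then show False using k(2) l(2) by (simp add: att_strict_iff_weak)
  next
    case 2
    then show False using above_l[OF k(1)] k(2) att_strict_not_indiff att_indiff_sym by blast
  next
    case 3
    then show False using above_k[OF l(1)] l(2) att_strict_not_indiff att_indiff_sym by blast
  qed
qed

lemma lex_pref_trans:
  assumes c: "clc_customer N K V vals c" and ijh: "i \<in> {1..N}" "j \<in> {1..N}" "h \<in> {1..N}"
    and "lex_pref c K vals P i j" "lex_pref c K vals P j h"
  shows "lex_pref c K vals P i h"
proof -
  have imp: "strict_total_on {0..K} (imp c)" using c unfolding clc_customer_def by blast
  obtain k where k: "k \<in> {0..K}" "att_strict c vals P k i j"
    and above_k: "\<And>k'. k' \<in> {0..K} \<Longrightarrow> imp c k' k \<Longrightarrow> att_indiff c vals P k' i j"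
    using \<open>lex_pref c K vals P i j\<close> by (elim lex_prefE) blast
  obtain l where l: "l \<in> {0..K}" "att_strict c vals P l j h"
    and above_l: "\<And>k'. k' \<in> {0..K} \<Longrightarrow> imp c k' l \<Longrightarrow> att_indiff c vals P k' j h"
    using \<open>lex_pref c K vals P j h\<close> by (elim lex_prefE) blast
  note trans = att_trans[OF c _ ijh]
  consider "k = l" | "imp c k l" | "imp c l k" using strict_total_on_total[OF imp k(1) l(1)] by blast
  then show ?thesis
  proof cases
    case 1
    show ?thesis
      by (rule lex_prefI[OF k(1)]) (use 1 k l above_k above_l trans in auto)
  next
    case 2
    show ?thesis
    proof (rule lex_prefI[OF k(1)])
      fix k' assume "k' \<in> {0..K}" "imp c k' k"
      moreover from this have "imp c k' l" using strict_total_on_trans[OF imp _ k(1) l(1)] 2 by blast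
      ultimately show "att_indiff c vals P k' i h" using above_k above_l trans by blast
    qed (use 2 k above_l trans in blast)
  next
    case 3
    show ?thesis
    proof (rule lex_prefI[OF l(1)])
      fix k' assume "k' \<in> {0..K}" "imp c k' l"
      moreover from this have "imp c k' k" using strict_total_on_trans[OF imp _ l(1) k(1)] 3 by blast
      ultimately show "att_indiff c vals P k' i h" using above_k above_l trans by blast
    qed (use 3 l above_k trans in blast)
  qed
qed

text \<open>Otherwise the most important attribute on which they differ would decide.\<close>
lemma lex_incomparable_indiff:
  assumes c: "clc_customer N K V vals c" and ij: "i \<in> {1..N}" "j \<in> {1..N}"
    and "\<not> lex_pref c K vals P i j" "\<not> lex_pref c K vals P j i" and k: "k \<in> {0..K}"
  shows "att_indiff c vals P k i j"
proof (rule ccontr)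
  assume "\<not> att_indiff c vals P k i j"
  have imp: "strict_total_on {0..K} (imp c)" using c unfolding clc_customer_def by blast
  define D where "D = {a \<in> {0..K}. \<not> att_indiff c vals P a i j}"
  have "D \<subseteq> {0..K}" "finite D" "D \<noteq> {}"
    using k \<open>\<not> att_indiff c vals P k i j\<close> unfolding D_def by auto
  then obtain a where a: "a \<in> D" and a_min: "\<forall>b\<in>D. \<not> imp c b a"
    using strict_total_on_ex_min[OF imp] by meson
  have a0K: "a \<in> {0..K}" using a unfolding D_def by blast
  have above: "att_indiff c vals P k' i j" if "k' \<in> {0..K}" "imp c k' a" for k'
    using a_min that unfolding D_def by blast
  have "att_strict c vals P a i j \<or> att_strict c vals P a j i"
    using a att_weak_total[OF c a0K ij, of P] unfolding D_def att_strict_iff_weak att_indiff_iff_weak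
    by blast
  then show False
    using lex_prefI[OF a0K, of c vals P] above att_indiff_sym assms(4,5) by metis
qed

lemma lex_pref_indiff_trans:
  assumes c: "clc_customer N K V vals c" and ijh: "i \<in> {1..N}" "j \<in> {1..N}" "h \<in> {1..N}"
    and "lex_pref c K vals P i j" and jh: "\<forall>k\<in>{0..K}. att_indiff c vals P k j h"
  shows "lex_pref c K vals P i h"
proof -
  obtain k where "k \<in> {0..K}" "att_strict c vals P k i j"
    and "\<And>k'. k' \<in> {0..K} \<Longrightarrow> imp c k' k \<Longrightarrow> att_indiff c vals P k' i j"
    using \<open>lex_pref c K vals P i j\<close> by (elim lex_prefE) blast
  then show ?thesis
    using jh att_indiff_trans[OF c _ ijh] att_strict_indiff_trans[OF c _ ijh]
    by (intro lex_prefI[of k]) auto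
qed

lemma indiff_lex_pref_trans:
  assumes c: "clc_customer N K V vals c" and ijh: "i \<in> {1..N}" "j \<in> {1..N}" "h \<in> {1..N}"
    and ij: "\<forall>k\<in>{0..K}. att_indiff c vals P k i j" and "lex_pref c K vals P j h"
  shows "lex_pref c K vals P i h"
proof -
  obtain k where "k \<in> {0..K}" "att_strict c vals P k j h"
    and "\<And>k'. k' \<in> {0..K} \<Longrightarrow> imp c k' k \<Longrightarrow> att_indiff c vals P k' j h"
    using \<open>lex_pref c K vals P j h\<close> by (elim lex_prefE) blast
  then show ?thesis
    using ij att_indiff_trans[OF c _ ijh] att_indiff_strict_trans[OF c _ ijh]
    by (intro lex_prefI[of k]) auto
qed

lemma indiff_not_lex_pref:
  "\<forall>k\<in>{0..K}. att_indiff c vals P k i j \<Longrightarrow> \<not> lex_pref c K vals P i j"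
  using att_strict_not_indiff unfolding lex_pref_def by blast

lemma ranks_above_asym:
  assumes c: "clc_customer N K V vals c" and ij: "i \<in> {1..N}" "j \<in> {1..N}"
    and "ranks_above c K vals P i j"
  shows "\<not> ranks_above c K vals P j i"
proof -
  have imp: "strict_total_on {0..K} (imp c)" and tb: "strict_total_on {1..N} (tb c)"
    using c unfolding clc_customer_def by blast+
  have "\<not> (tb c i j \<and> tb c j i)"
    using strict_total_on_irrefl[OF tb ij(1)] strict_total_on_trans[OF tb ij(1) ij(2) ij(1)] by blast
  then show ?thesis
    using assms(4) lex_pref_asym[OF imp] unfolding ranks_above_def by blast
qed

lemma ranks_above_total:
  assumes c: "clc_customer N K V vals c" and ij: "i \<in> {1..N}" "j \<in> {1..N}" "i \<noteq> j"
  shows "ranks_above c K vals P i j \<or> ranks_above c K vals P j i"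
proof -
  have "strict_total_on {1..N} (tb c)" using c unfolding clc_customer_def by blast
  then show ?thesis using strict_total_on_total[OF _ ij] unfolding ranks_above_def by blast
qed

lemma ranks_above_trans:
  assumes c: "clc_customer N K V vals c" and ijh: "i \<in> {1..N}" "j \<in> {1..N}" "h \<in> {1..N}"
    and ij: "ranks_above c K vals P i j" and jh: "ranks_above c K vals P j h"
  shows "ranks_above c K vals P i h"
proof -
  have tb: "strict_total_on {1..N} (tb c)" using c unfolding clc_customer_def by blast
  note indiff = lex_incomparable_indiff[OF c]
  note lex_trans = lex_pref_trans[OF c ijh] lex_pref_indiff_trans[OF c ijh] indiff_lex_pref_trans[OF c ijh]
  show ?thesis
  proof (cases "lex_pref c K vals P i j"; cases "lex_pref c K vals P j h")
    assume "\<not> lex_pref c K vals P i j" "\<not> lex_pref c K vals P j h"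
    then have "tb c i j" "tb c j h" "\<forall>k\<in>{0..K}. att_indiff c vals P k i h"
      using ij jh indiff[OF ijh(1,2)] indiff[OF ijh(2,3)] att_indiff_trans[OF c _ ijh]
      unfolding ranks_above_def by blast+
    moreover from this have "tb c i h" using strict_total_on_trans[OF tb ijh] by blast
    ultimately show ?thesis
      using indiff_not_lex_pref att_indiff_sym unfolding ranks_above_def by metis
  qed (use ij jh indiff[OF ijh(1,2)] indiff[OF ijh(2,3)] lex_trans in
       \<open>auto simp: ranks_above_def\<close>)
qed

lemma ranks_above_price_order_cong:
  assumes lt: "P i < P j \<longleftrightarrow> Q i < Q j" and gt: "P j < P i \<longleftrightarrow> Q j < Q i"
    and eq: "P i = P j \<longleftrightarrow> Q i = Q j"
  shows "ranks_above c K vals P i j \<longleftrightarrow> ranks_above c K vals Q i j"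
proof -
  have eq': "P j = P i \<longleftrightarrow> Q j = Q i" using eq by auto
  have "att_strict c vals P k i j = att_strict c vals Q k i j"
    "att_strict c vals P k j i = att_strict c vals Q k j i"
    "att_indiff c vals P k i j = att_indiff c vals Q k i j"
    "att_indiff c vals P k j i = att_indiff c vals Q k j i" for k
    unfolding att_strict_def att_indiff_def by (simp_all only: lt gt eq eq')
  then show ?thesis unfolding ranks_above_def lex_pref_def by simp
qed

lemma ranks_above_cong:
  "P i = Q i \<Longrightarrow> P j = Q j \<Longrightarrow> ranks_above c K vals P i j \<longleftrightarrow> ranks_above c K vals Q i j"
  by (rule ranks_above_price_order_cong) auto

text \<open>If i was preferred for a non-price attribute ranked below price and the prices now differ,
  price itself decides in favour of i.\<close>
lemma lex_pref_price_mono: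
  assumes imp: "strict_total_on {0..K} (imp c)"
    and Qi: "Q i \<le> P i" and Qj: "P j \<le> Q j" and "lex_pref c K vals P i j"
  shows "lex_pref c K vals Q i j"
proof -
  obtain k where k: "k \<in> {0..K}" "att_strict c vals P k i j"
    and above: "\<And>k'. k' \<in> {0..K} \<Longrightarrow> imp c k' k \<Longrightarrow> att_indiff c vals P k' i j"
    using \<open>lex_pref c K vals P i j\<close> by (elim lex_prefE) blast
  have same: "att_indiff c vals Q k' i j = att_indiff c vals P k' i j" if "k' \<noteq> 0" for k'
    using that by (simp add: att_indiff_def)
  have zero_above_k: "imp c k' k" if "k' \<in> {0..K}" "imp c k' 0" "k = 0 \<or> imp c 0 k" for k'
    using that strict_total_on_irrefl[OF imp] strict_total_on_trans[OF imp _ _ k(1)] by fastforce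
  have nonzero: "k' \<noteq> 0" if "imp c k' 0" for k'
    using that strict_total_on_irrefl[OF imp, of 0] by (cases k') auto
  show ?thesis
  proof (cases "Q i < Q j \<and> (k = 0 \<or> imp c 0 k)")
    case True
    show ?thesis
    proof (rule lex_prefI[of 0])
      show "att_strict c vals Q 0 i j" using True by (simp add: att_strict_def)
    qed (use True above same zero_above_k nonzero in auto)
  next
    case False
    have "k \<noteq> 0" using False k(2) Qi Qj by (auto simp: att_strict_def split: if_splits)
    show ?thesis
    proof (rule lex_prefI[OF k(1)])
      show "att_strict c vals Q k i j" using k(2) \<open>k \<noteq> 0\<close> by (simp add: att_strict_def)
    next
      fix k' assume k': "k' \<in> {0..K}" "imp c k' k"
      show "att_indiff c vals Q k' i j"
      proof (cases "k' = 0")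
        case True
        then have "P i = P j" using above[OF k'] by (simp add: att_indiff_def)
        then show ?thesis using True False k' Qi Qj by (auto simp: att_indiff_def)
      qed (use above[OF k'] same in auto)
    qed
  qed
qed

lemma ranks_above_price_mono:
  assumes imp: "strict_total_on {0..K} (imp c)"
    and "Q i \<le> P i" "P j \<le> Q j" and "ranks_above c K vals P i j"
  shows "ranks_above c K vals Q i j"
  using assms lex_pref_price_mono[OF imp] unfolding ranks_above_def by metis

section \<open>Purchases of a single customer\<close>

lemma buys_price_mono:
  assumes c: "clc_customer N K V vals c" and Qi: "Q i \<le> P i"
    and Qj: "\<And>j. j \<in> {1..N} \<Longrightarrow> j \<noteq> i \<Longrightarrow> P j \<le> Q j"
    and "buys c N K vals w P i"
  shows "buys c N K vals w Q i"
proof -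
  have imp: "strict_total_on {0..K} (imp c)" using c unfolding clc_customer_def by blast
  have "ranks_above c K vals Q i j" if "j \<in> consider_set c N K vals w Q" "j \<noteq> i" for j
  proof -
    have "P j \<le> Q j" using Qj that unfolding consider_set_def by auto
    then have "j \<in> consider_set c N K vals w P" using that unfolding consider_set_def by auto
    then show ?thesis
      using \<open>buys c N K vals w P i\<close> \<open>j \<noteq> i\<close> ranks_above_price_mono[OF imp Qi \<open>P j \<le> Q j\<close>]
      unfolding buys_def by blast
  qed
  moreover have "i \<in> consider_set c N K vals w Q"
    using \<open>buys c N K vals w P i\<close> Qi unfolding buys_def consider_set_def by auto
  ultimately show ?thesis unfolding buys_def by blast
qed

lemma buys_unique:
  assumes c: "clc_customer N K V vals c"
    and "buys c N K vals w P i" "buys c N K vals w P j"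
  shows "i = j"
proof (rule ccontr)
  assume "i \<noteq> j"
  have "i \<in> consider_set c N K vals w P" "j \<in> consider_set c N K vals w P"
    using assms(2,3) unfolding buys_def by auto
  moreover from this have "i \<in> {1..N}" "j \<in> {1..N}" unfolding consider_set_def by auto
  ultimately show False
    using assms(2,3) \<open>i \<noteq> j\<close> ranks_above_asym[OF c] unfolding buys_def by metis
qed

text \<open>The lost customer ranks j above i at price 0, hence at every price of j below p i (only the
  order of the two prices matters), and then j beats every other seller since i did.\<close>
lemma buys_rival_undercut:
  assumes c: "clc_customer N K V vals c"
    and ij: "i \<in> {1..N}" "j \<in> {1..N}" "i \<noteq> j" and y: "y < p i" and pos: "0 < p i"
    and bi: "buys c N K vals w p i" and lost: "\<not> buys c N K vals w (p(j := 0)) i"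
  shows "buys c N K vals w (p(j := y)) j"
proof -
  let ?cs = "consider_set c N K vals w"
  from bi have iw: "p i \<le> w"
    and i_first: "\<And>h. h \<in> ?cs p \<Longrightarrow> h \<noteq> i \<Longrightarrow> ranks_above c K vals p i h"
    and "i \<in> ?cs (p(j := 0))"
    using ij unfolding buys_def consider_set_def by auto
  with lost obtain h where h: "h \<in> ?cs (p(j := 0))" "h \<noteq> i" "\<not> ranks_above c K vals (p(j := 0)) i h"
    unfolding buys_def by blast
  have "h = j"
  proof (rule ccontr)
    assume "h \<noteq> j"
    then have "h \<in> ?cs p" using h(1) unfolding consider_set_def by auto
    then show False
      using i_first h(2,3) ranks_above_cong[of "p(j := 0)" i p h] \<open>h \<noteq> j\<close> ij(3) by auto
  qed
  have "ranks_above c K vals (p(j := y)) i j \<longleftrightarrow> ranks_above c K vals (p(j := 0)) i j"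
    using ij y pos by (intro ranks_above_price_order_cong) auto
  then have j_above_i: "ranks_above c K vals (p(j := y)) j i"
    using h(3) \<open>h = j\<close> ranks_above_total[OF c ij] by auto
  have "ranks_above c K vals (p(j := y)) j h'" if "h' \<in> ?cs (p(j := y))" "h' \<noteq> j" for h'
  proof (cases "h' = i")
    case False
    then have "h' \<in> {1..N}" "ranks_above c K vals (p(j := y)) i h'"
      using that i_first ranks_above_cong[of "p(j := y)" i p h'] ij(3)
      unfolding consider_set_def by auto
    then show ?thesis using ranks_above_trans[OF c ij(2) ij(1) _ j_above_i] by blast
  qed (use j_above_i in simp)
  moreover have "j \<in> ?cs (p(j := y))"
    using h(1) \<open>h = j\<close> ij y iw unfolding consider_set_def by auto
  ultimately show ?thesis unfolding buys_def by blast
qed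

lemma buys_lost_to_tied_rival:
  assumes c: "clc_customer N K V vals c"
    and i: "i \<in> {1..N}" "i \<notin> S" and above_in_S: "\<And>j. j \<in> {1..N} \<Longrightarrow> p i < p j \<Longrightarrow> j \<in> S"
    and nonneg: "\<And>j. j \<in> {1..N} \<Longrightarrow> 0 \<le> p j" and pos: "0 < p i"
    and bi: "buys c N K vals w p i" and lost: "\<not> buys c N K vals w ((prices_on S p)(i := p i)) i"
  shows "\<exists>j\<in>{1..N}. j \<noteq> i \<and> p j = p i \<and> \<not> buys c N K vals w (p(j := 0)) i"
proof -
  let ?cs = "consider_set c N K vals w" and ?P = "(prices_on S p)(i := p i)"
  from bi have iw: "p i \<le> w"
    and i_first: "\<And>h. h \<in> ?cs p \<Longrightarrow> h \<noteq> i \<Longrightarrow> ranks_above c K vals p i h"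
    and "i \<in> ?cs ?P"
    using i unfolding buys_def consider_set_def by auto
  with lost obtain j where j: "j \<in> ?cs ?P" "j \<noteq> i" "\<not> ranks_above c K vals ?P i j"
    unfolding buys_def by blast
  then have jN: "j \<in> {1..N}" unfolding consider_set_def by auto
  have j_in_cs: "j \<in> ?cs p" if "p j \<le> p i"
    using j(1) that iw unfolding consider_set_def by auto
  have "j \<notin> S"
  proof
    assume "j \<in> S"
    then have "?P j = p j" using j(2) by (simp add: prices_on_def)
    then have "j \<in> ?cs p" using j(1) unfolding consider_set_def by auto
    then show False using i_first j(2,3) ranks_above_cong[of ?P i p j] \<open>?P j = p j\<close> by auto
  qed
  then have "?P j = 0" "p j \<le> p i"
    using j(2) above_in_S[OF jN] by (auto simp: prices_on_def not_less[symmetric])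
  have tied: "p j = p i"
  proof (rule ccontr)
    assume "p j \<noteq> p i"
    then have "ranks_above c K vals p i j \<longleftrightarrow> ranks_above c K vals ?P i j"
      using \<open>?P j = 0\<close> \<open>p j \<le> p i\<close> pos nonneg[OF jN] by (intro ranks_above_price_order_cong) auto
    then show False using i_first j_in_cs \<open>p j \<le> p i\<close> j(2,3) by auto
  qed
  have "\<not> buys c N K vals w (p(j := 0)) i"
  proof
    assume "buys c N K vals w (p(j := 0)) i"
    moreover have "j \<in> ?cs (p(j := 0))" using j(1) jN iw pos unfolding consider_set_def by auto
    ultimately show False
      using j(2,3) \<open>?P j = 0\<close> ranks_above_cong[of "p(j := 0)" i ?P j] unfolding buys_def by auto
  qed
  then show ?thesis using jN j(2) tied by blast
qed

section \<open>Demand\<close>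

lemma clc_instance_customer:
  "clc_instance N K V vals vb Theta f \<Longrightarrow> c \<in> space Theta \<Longrightarrow> clc_customer N K V vals c"
  unfolding clc_instance_def clc_customer_def by blast

lemma clc_instanceD:
  assumes "clc_instance N K V vals vb Theta f"
  shows "prob_space Theta"
    and "(\<lambda>x. f (fst x) (snd x)) \<in> borel_measurable (Theta \<Otimes>\<^sub>M lborel)"
    and "c \<in> space Theta \<Longrightarrow> w \<in> {0..vb} \<Longrightarrow> 0 \<le> f c w"
    and "c \<in> space Theta \<Longrightarrow> (f c has_integral 1) {0..vb}"
    and "buy_set Theta N K vals P i \<in> sets (Theta \<Otimes>\<^sub>M lborel)"
  using assms unfolding clc_instance_def by simp_all

lemma wtp_density_nn_integral:
  assumes C: "clc_instance N K V vals vb Theta f" and c: "c \<in> space Theta"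
  shows "(\<integral>\<^sup>+ w. ennreal (f c w * indicator {0..vb} w) \<partial>lborel) = 1"
proof -
  define h where "h = (\<lambda>w. f c w * indicator {0..vb} w)"
  have "(\<lambda>w. (c, w)) \<in> measurable lborel (Theta \<Otimes>\<^sub>M lborel)"
    using c by (auto intro!: measurable_Pair)
  from measurable_comp[OF this clc_instanceD(2)[OF C]] have "f c \<in> borel_measurable borel"
    by (simp add: comp_def)
  then have "h \<in> borel_measurable borel" unfolding h_def by measurable
  moreover have "\<And>w. 0 \<le> h w" unfolding h_def using clc_instanceD(3)[OF C c] by (simp add: indicator_def)
  moreover have "(h has_integral 1) UNIV"
  proof -
    have "((\<lambda>w. if w \<in> {0..vb} then f c w else 0) has_integral 1) UNIV"
      using clc_instanceD(4)[OF C c] by (simp only: has_integral_restrict_UNIV)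
    moreover have "(\<lambda>w. if w \<in> {0..vb} then f c w else 0) = h"
      unfolding h_def by (auto simp: indicator_def)
    ultimately show ?thesis by simp
  qed
  ultimately show ?thesis using nn_integral_has_integral_lborel[of h 1] unfolding h_def by simp
qed

lemma prob_space_cust_meas:
  assumes C: "clc_instance N K V vals vb Theta f"
  shows "prob_space (cust_meas Theta f vb)"
proof
  define g where "g = (\<lambda>x. ennreal (f (fst x) (snd x) * indicator {0..vb} (snd x)))"
  have g_meas: "g \<in> borel_measurable (Theta \<Otimes>\<^sub>M lborel)"
    using clc_instanceD(2)[OF C] unfolding g_def by measurable
  have "emeasure (cust_meas Theta f vb) (space (cust_meas Theta f vb))
      = (\<integral>\<^sup>+ x. g x * indicator (space (Theta \<Otimes>\<^sub>M lborel)) x \<partial>(Theta \<Otimes>\<^sub>M lborel))"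
    unfolding cust_meas_def g_def[symmetric]
    by (simp only: space_density emeasure_density[OF g_meas sets.top])
  also have "\<dots> = (\<integral>\<^sup>+ x. g x \<partial>(Theta \<Otimes>\<^sub>M lborel))"
    by (rule nn_integral_cong) simp
  also have "\<dots> = (\<integral>\<^sup>+ c. \<integral>\<^sup>+ w. g (c, w) \<partial>lborel \<partial>Theta)"
    by (rule lborel.nn_integral_fst[OF g_meas, symmetric])
  also have "\<dots> = (\<integral>\<^sup>+ c. 1 \<partial>Theta)"
    unfolding g_def by (intro nn_integral_cong) (simp add: wtp_density_nn_integral[OF C])
  also have "\<dots> = 1" using prob_space.emeasure_space_1[OF clc_instanceD(1)[OF C]] by simp
  finally show "emeasure (cust_meas Theta f vb) (space (cust_meas Theta f vb)) = 1" .
qed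

lemma finite_measure_cust_meas:
  "clc_instance N K V vals vb Theta f \<Longrightarrow> finite_measure (cust_meas Theta f vb)"
  using prob_space_cust_meas unfolding prob_space_def by blast

lemma buy_set_sets:
  assumes "clc_instance N K V vals vb Theta f"
  shows "buy_set Theta N K vals P i \<in> sets (cust_meas Theta f vb)"
proof -
  have "sets (cust_meas Theta f vb) = sets (Theta \<Otimes>\<^sub>M lborel)" unfolding cust_meas_def by simp
  with clc_instanceD(5)[OF assms] show ?thesis by simp
qed

lemma mem_buy_set_iff:
  "x \<in> buy_set Theta N K vals P i \<longleftrightarrow> x \<in> space (Theta \<Otimes>\<^sub>M lborel) \<and> buys (fst x) N K vals (snd x) P i"
  unfolding buy_set_def by simp

lemma buy_setD:
  assumes C: "clc_instance N K V vals vb Theta f" and x: "x \<in> buy_set Theta N K vals P i"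
  shows "x \<in> space (Theta \<Otimes>\<^sub>M lborel)" and "buys (fst x) N K vals (snd x) P i"
    and "clc_customer N K V vals (fst x)"
proof -
  show x_space: "x \<in> space (Theta \<Otimes>\<^sub>M lborel)" and "buys (fst x) N K vals (snd x) P i"
    using x unfolding buy_set_def by auto
  have "fst x \<in> space Theta" using x_space by (auto simp: space_pair_measure)
  then show "clc_customer N K V vals (fst x)" by (rule clc_instance_customer[OF C])
qed

lemma buy_set_price_mono:
  assumes C: "clc_instance N K V vals vb Theta f" and Qi: "Q i \<le> P i"
    and Qj: "\<And>j. j \<in> {1..N} \<Longrightarrow> j \<noteq> i \<Longrightarrow> P j \<le> Q j"
  shows "buy_set Theta N K vals P i \<subseteq> buy_set Theta N K vals Q i"
proof
  fix x assume x: "x \<in> buy_set Theta N K vals P i"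
  have "buys (fst x) N K vals (snd x) Q i"
    using buys_price_mono[OF buy_setD(3)[OF C x] Qi Qj buy_setD(2)[OF C x]] .
  with buy_setD(1)[OF C x] show "x \<in> buy_set Theta N K vals Q i" unfolding buy_set_def by blast
qed

lemma demand_tied_rival_undercut:
  assumes C: "clc_instance N K V vals vb Theta f"
    and ij: "i \<in> {1..N}" "j \<in> {1..N}" "i \<noteq> j" and tied: "p j = p i" and pos: "0 < p i"
    and y: "y < p i"
  shows "demand N K vals Theta f vb j p
      + measure (cust_meas Theta f vb) (buy_set Theta N K vals p i - buy_set Theta N K vals (p(j := 0)) i)
    \<le> demand N K vals Theta f vb j (p(j := y))"
proof -
  interpret finite_measure "cust_meas Theta f vb" by (rule finite_measure_cust_meas[OF C])
  let ?B = "\<lambda>P k. buy_set Theta N K vals P k"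
  define W where "W = ?B p i - ?B (p(j := 0)) i"
  have W_sub: "W \<subseteq> ?B (p(j := y)) j"
  proof
    fix x assume "x \<in> W"
    then have x: "x \<in> ?B p i" "x \<notin> ?B (p(j := 0)) i" unfolding W_def by auto
    then have "\<not> buys (fst x) N K vals (snd x) (p(j := 0)) i"
      unfolding mem_buy_set_iff by blast
    then have "buys (fst x) N K vals (snd x) (p(j := y)) j"
      using buys_rival_undercut[OF buy_setD(3)[OF C x(1)] ij y pos buy_setD(2)[OF C x(1)]] by blast
    then show "x \<in> ?B (p(j := y)) j" using x(1) unfolding mem_buy_set_iff by blast
  qed
  have "?B p j \<subseteq> ?B (p(j := y)) j"
    by (rule buy_set_price_mono[OF C]) (use y tied in auto)
  moreover have "W \<inter> ?B p j = {}"
    using buys_unique[OF buy_setD(3)[OF C] buy_setD(2)[OF C] buy_setD(2)[OF C]] ij(3)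
    unfolding W_def by blast
  ultimately have
      "measure (cust_meas Theta f vb) (?B p j \<union> W) \<le> demand N K vals Theta f vb j (p(j := y))"
      "measure (cust_meas Theta f vb) (?B p j \<union> W)
         = demand N K vals Theta f vb j p + measure (cust_meas Theta f vb) W"
    using W_sub unfolding demand_def W_def
    by (auto intro!: finite_measure_mono finite_measure_Union simp: buy_set_sets[OF C])
  then show ?thesis unfolding W_def by simp
qed

section \<open>Local Nash equilibria\<close>

lemma is_LNE_nonneg: "is_LNE N vb R p \<Longrightarrow> j \<in> {1..N} \<Longrightarrow> 0 \<le> p j"
  unfolding is_LNE_def by auto

lemma is_LNE_local_max:
  assumes "is_LNE N vb R p" and "i \<in> {1..N}"
  obtains e where "e > 0" "\<And>x. \<bar>x - p i\<bar> < e \<Longrightarrow> R i (p(i := x)) \<le> R i p"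
proof -
  from assms obtain U where U: "open U" "p i \<in> U" "\<forall>x\<in>closure U. R i (p(i := x)) \<le> R i p"
    unfolding is_LNE_def by blast
  then obtain e where "e > 0" "ball (p i) e \<subseteq> U" by (meson openE)
  moreover have "x \<in> ball (p i) e" if "\<bar>x - p i\<bar> < e" for x
    using that by (simp add: dist_real_def abs_minus_commute)
  ultimately show thesis using that U(3) closure_subset by blast
qed

lemma LNE_tied_rival_loss_null:
  assumes C: "clc_instance N K V vals vb Theta f"
    and L: "is_LNE N vb (revenue N K vals Theta f vb) p"
    and ij: "i \<in> {1..N}" "j \<in> {1..N}" "i \<noteq> j" and tied: "p j = p i" and pos: "0 < p i"
  shows "measure (cust_meas Theta f vb)
     (buy_set Theta N K vals p i - buy_set Theta N K vals (p(j := 0)) i) = 0"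
proof -
  let ?D = "demand N K vals Theta f vb j p"
  let ?m = "measure (cust_meas Theta f vb)
    (buy_set Theta N K vals p i - buy_set Theta N K vals (p(j := 0)) i)"
  obtain e where e: "e > 0" "\<And>x. \<bar>x - p j\<bar> < e \<Longrightarrow>
      revenue N K vals Theta f vb j (p(j := x)) \<le> revenue N K vals Theta f vb j p"
    using is_LNE_local_max[OF L ij(2)] by blast
  have "?D + ?m \<le> ?D"
  proof (rule le_of_mult_le_left_nbhd[OF pos, of "min e (p i)"])
    fix y assume y: "p i - min e (p i) < y" "y < p i"
    then have "y * (?D + ?m) \<le> y * demand N K vals Theta f vb j (p(j := y))"
      using demand_tied_rival_undercut[OF C ij tied pos] by (simp add: mult_left_mono)
    also have "\<dots> \<le> revenue N K vals Theta f vb j p"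
      using e(2)[of y] y tied unfolding revenue_def by simp
    finally show "y * (?D + ?m) \<le> p i * ?D" using tied unfolding revenue_def by simp
  qed (use e pos in simp)
  then show ?thesis using measure_nonneg[of "cust_meas Theta f vb"] by (simp add: order.antisym)
qed

lemma LNE_demand_prices_on:
  assumes C: "clc_instance N K V vals vb Theta f"
    and L: "is_LNE N vb (revenue N K vals Theta f vb) p"
    and i: "i \<in> {1..N}" "i \<notin> S" and above_in_S: "\<And>j. j \<in> {1..N} \<Longrightarrow> p i < p j \<Longrightarrow> j \<in> S"
    and pos: "0 < p i"
  shows "demand N K vals Theta f vb i ((prices_on S p)(i := p i)) = demand N K vals Theta f vb i p"
proof -
  let ?M = "cust_meas Theta f vb"
  interpret finite_measure ?M by (rule finite_measure_cust_meas[OF C])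
  let ?B = "\<lambda>P k. buy_set Theta N K vals P k" and ?P = "(prices_on S p)(i := p i)"
  define J where "J = {j \<in> {1..N}. j \<noteq> i \<and> p j = p i}"
  have fJ: "finite J" unfolding J_def by simp
  have sub: "?B ?P i \<subseteq> ?B p i"
  proof (rule buy_set_price_mono[OF C])
    fix j assume "j \<in> {1..N}"
    then show "?P j \<le> p j" using is_LNE_nonneg[OF L] by (simp add: prices_on_def)
  qed simp
  have lost: "?B p i - ?B ?P i \<subseteq> (\<Union>j\<in>J. ?B p i - ?B (p(j := 0)) i)"
  proof
    fix x assume "x \<in> ?B p i - ?B ?P i"
    then have x: "x \<in> ?B p i" "\<not> buys (fst x) N K vals (snd x) ?P i"
      using mem_buy_set_iff[of x] by blast+
    from buys_lost_to_tied_rival[OF buy_setD(3)[OF C x(1)] i above_in_S is_LNE_nonneg[OF L] pos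
        buy_setD(2)[OF C x(1)] x(2)]
    obtain j where "j \<in> {1..N}" "j \<noteq> i" "p j = p i"
      and "\<not> buys (fst x) N K vals (snd x) (p(j := 0)) i"
      by blast
    then have "j \<in> J" "x \<notin> ?B (p(j := 0)) i" unfolding J_def mem_buy_set_iff by simp_all
    with x(1) show "x \<in> (\<Union>j\<in>J. ?B p i - ?B (p(j := 0)) i)" by blast
  qed
  have "measure ?M (?B p i - ?B ?P i) \<le> measure ?M (\<Union>j\<in>J. ?B p i - ?B (p(j := 0)) i)"
    by (rule finite_measure_mono[OF lost], intro sets.finite_UN fJ sets.Diff buy_set_sets[OF C])
  also have "\<dots> \<le> (\<Sum>j\<in>J. measure ?M (?B p i - ?B (p(j := 0)) i))"
    by (rule finite_measure_subadditive_finite[OF fJ]) (use buy_set_sets[OF C] in auto)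
  also have "\<dots> = 0"
    using LNE_tied_rival_loss_null[OF C L i(1)] pos unfolding J_def by (intro sum.neutral) auto
  finally have "measure ?M (?B p i - ?B ?P i) = 0" by (simp add: order.antisym)
  then show ?thesis
    using finite_measure_Diff[OF buy_set_sets[OF C] buy_set_sets[OF C] sub] unfolding demand_def by simp
qed

lemma LNE_local_max_prices_on:
  assumes C: "clc_instance N K V vals vb Theta f"
    and L: "is_LNE N vb (revenue N K vals Theta f vb) p"
    and i: "i \<in> {1..N}" "i \<notin> S" and above_in_S: "\<And>j. j \<in> {1..N} \<Longrightarrow> p i < p j \<Longrightarrow> j \<in> S"
  shows "\<exists>e>0. \<forall>x\<ge>0. \<bar>x - p i\<bar> < e \<longrightarrow>
     revenue N K vals Theta f vb i ((prices_on S p)(i := x))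
       \<le> revenue N K vals Theta f vb i ((prices_on S p)(i := p i))"
proof -
  let ?R = "revenue N K vals Theta f vb"
  interpret finite_measure "cust_meas Theta f vb" by (rule finite_measure_cust_meas[OF C])
  obtain e where e: "e > 0" "\<And>x. \<bar>x - p i\<bar> < e \<Longrightarrow> ?R i (p(i := x)) \<le> ?R i p"
    using is_LNE_local_max[OF L i(1)] by blast
  have same_at_p: "?R i ((prices_on S p)(i := p i)) = ?R i p"
    using LNE_demand_prices_on[OF C L i above_in_S] is_LNE_nonneg[OF L i(1)]
    unfolding revenue_def by (cases "p i = 0") auto
  have below: "?R i ((prices_on S p)(i := x)) \<le> ?R i (p(i := x))" if "0 \<le> x" for x
  proof -
    have "buy_set Theta N K vals ((prices_on S p)(i := x)) i \<subseteq> buy_set Theta N K vals (p(i := x)) i"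
    proof (rule buy_set_price_mono[OF C])
      fix j assume "j \<in> {1..N}" "j \<noteq> i"
      then show "((prices_on S p)(i := x)) j \<le> (p(i := x)) j"
        using is_LNE_nonneg[OF L] by (simp add: prices_on_def)
    qed simp
    then show ?thesis
      using that unfolding revenue_def demand_def
      by (auto intro!: mult_left_mono finite_measure_mono simp: buy_set_sets[OF C])
  qed
  have "?R i ((prices_on S p)(i := x)) \<le> ?R i ((prices_on S p)(i := p i))"
    if "0 \<le> x" "\<bar>x - p i\<bar> < e" for x
    using below[OF that(1)] e(2)[OF that(2)] same_at_p by linarith
  then show ?thesis using e(1) by blast
qed

theorem theorem4p2:
  fixes N K :: nat and V :: "nat \<Rightarrow> 'v set" and vals :: "nat \<Rightarrow> nat \<Rightarrow> 'v"
    and vb :: real and Theta :: "'v cust measure" and f :: "'v cust \<Rightarrow> real \<Rightarrow> real"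
    and p :: "nat \<Rightarrow> real"
  assumes "clc_instance N K V vals vb Theta f"
    and "is_LNE N vb (revenue N K vals Theta f vb) p"
  shows "\<exists>\<pi>. is_VOP N vb (revenue N K vals Theta f vb) \<pi> p"
proof -
  obtain \<pi> where bij: "bij_betw \<pi> {1..N} {1..N}"
    and desc: "\<And>l m. l \<in> {1..N} \<Longrightarrow> m \<in> {1..N} \<Longrightarrow> l \<le> m \<Longrightarrow> p (\<pi> m) \<le> p (\<pi> l)"
    by (rule ex_bij_sorted_desc[of N p]) blast
  have range: "\<And>i. i \<in> {1..N} \<Longrightarrow> p i \<in> {0..vb}" and \<pi>_range: "\<And>l. l \<in> {1..N} \<Longrightarrow> \<pi> l \<in> {1..N}"
    using assms(2) bij_betw_apply[OF bij] unfolding is_LNE_def by auto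
  note local_max =
    LNE_local_max_prices_on[OF assms \<pi>_range sorted_desc_prefix[where p = p, OF bij desc]]
  have "is_VOP N vb (revenue N K vals Theta f vb) \<pi> p"
    unfolding is_VOP_def
    by (intro conjI ballI impI bij) (use range \<pi>_range desc local_max in \<open>fastforce+\<close>)
  then show ?thesis by blast
qed

end
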